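(* For each $n\ge1$, $SH_n=\sum_{(p,\overline{\sigma})\in\mathrm{Gar}(n)}R_{\lambda(p)}$.
   Context: Parking functions: an $n$-tuple $p$ of positive integers whose $i$-th smallest entry is at most $i$ for each $i$; $\mathrm{Pf}(n)$ their set; $p$ sorted if weakly increasing; $\alpha_k(p)=\#\{j:p_j=k\}$; $\lambda(p)$ the partition formed by the nonzero $\alpha_k(p)$. A sorted naive shifted parking function of size $n$ is a pair $(p,\overline{\sigma})$ with $p\in\mathrm{Pf}(n)$ sorted and $\overline{\sigma}\in\{-1,0,1\}^n$ with $\overline{\sigma}_k=0$ iff $\alpha_k(p)=0$. Let $\upsilon_i=0,1,2$ according as $\alpha_i(p)=0$, $\alpha_i(p)$ odd, or $\alpha_i(p)>0$ even. $(p,\overline{\sigma})$ is a garage if for all $i<j$ with $\upsilon_i=\upsilon_j=2$ such that every prefix of the word $\upsilon_{i+1}\cdots\upsilon_{j-1}$ has at least as many $2$'s as $0$'s, $\overline{\sigma}_i=\overline{\sigma}_j$. $\mathrm{Gar}(n)$ is the set of garages of size $n$. Symmetric functions: $h_k,e_k,p_k$ complete homogeneous, elementary, power sums; $P_0=1$, $P_k=\frac12\sum_{i=0}^kh_ie_{k-i}$ for $k\geq 1$; $R_m=P_m$ for $m$ odd and $R_m=\sum_{i=1}^{m/2}P_{2i}P_{m-2i}$ for $m$ even; $R_\lambda=\prod_iR_{\lambda_i}$. $\mathtt{sh}$ is the algebra endomorphism of $\mathrm{Sym}$ with $p_{2k-1}\mapsto2p_{2k-1}$, $p_{2k}\mapsto0$;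 $PF_n=\sum h_{\lambda(p)}$ over sorted $p\in\mathrm{Pf}(n)$; $SH_n=\mathtt{sh}(PF_n)$. *)

theory Defs
  imports Complex_Main "HOL-Library.Poly_Mapping" "HOL-Library.Multiset" "HOL-Library.Sublist"
begin

section \<open>The ring of symmetric functions over the rationals\<close>

text \<open>
  A monomial in the variables \<open>x\<^sub>0, x\<^sub>1, \<dots>\<close> is a finitely supported exponent vector, and a formal
  power series is the function sending a monomial to its coefficient.
\<close>

type_synonym mono = "nat \<Rightarrow>\<^sub>0 nat"

definition mono_deg :: "mono \<Rightarrow> nat" where
  "mono_deg m = (\<Sum>i\<in>Poly_Mapping.keys m. Poly_Mapping.lookup m i)"

definition splits :: "mono \<Rightarrow> (mono \<times> mono) set" where
  "splits m = {(a, b). a + b = m}"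

text \<open>For a bijection \<open>\<pi>\<close>, \<open>map_key \<pi> m\<close> has exponent vector \<open>lookup m \<circ> \<pi>\<close>.\<close>

definition symmetric_series :: "(mono \<Rightarrow> rat) \<Rightarrow> bool" where
  "symmetric_series f \<longleftrightarrow> (\<forall>\<pi> m. bij \<pi> \<longrightarrow> f (Poly_Mapping.map_key \<pi> m) = f m)"

definition bounded_degree :: "(mono \<Rightarrow> rat) \<Rightarrow> bool" where
  "bounded_degree f \<longleftrightarrow> (\<exists>d. \<forall>m. mono_deg m > d \<longrightarrow> f m = 0)"

lemma lookup_le_mono_deg: "Poly_Mapping.lookup m i \<le> mono_deg m"
proof (cases "i \<in> Poly_Mapping.keys m")
  case True
  then show ?thesis unfolding mono_deg_def by (intro member_le_sum) auto
next
  case False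
  then show ?thesis by (simp add: in_keys_iff)
qed

lemma mono_deg_superset:
  assumes "finite A" "Poly_Mapping.keys m \<subseteq> A"
  shows "mono_deg m = (\<Sum>i\<in>A. Poly_Mapping.lookup m i)"
  unfolding mono_deg_def using assms
  by (intro sum.mono_neutral_left) (auto simp: in_keys_iff)

lemma mono_deg_plus: "mono_deg (a + b) = mono_deg a + mono_deg b"
proof -
  let ?A = "Poly_Mapping.keys a \<union> Poly_Mapping.keys b"
  have "mono_deg (a + b) = (\<Sum>i\<in>?A. Poly_Mapping.lookup (a + b) i)"
    using Poly_Mapping.keys_add[of a b] by (intro mono_deg_superset) auto
  also have "\<dots> = mono_deg a + mono_deg b"
    by (simp add: lookup_add sum.distrib mono_deg_superset[of ?A a] mono_deg_superset[of ?A b])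
  finally show ?thesis .
qed

lemma mono_deg_zero [simp]: "mono_deg 0 = 0"
  by (simp add: mono_deg_def)

lemma mono_deg_single [simp]: "mono_deg (Poly_Mapping.single i k) = k"
  by (simp add: mono_deg_def)

lemma keys_map_key_bij:
  assumes "bij \<pi>"
  shows "Poly_Mapping.keys (Poly_Mapping.map_key \<pi> m) = \<pi> -` Poly_Mapping.keys m"
  using assms by (auto simp: in_keys_iff map_key.rep_eq bij_is_inj)

lemma lookup_map_key_bij:
  "bij \<pi> \<Longrightarrow> Poly_Mapping.lookup (Poly_Mapping.map_key \<pi> m) i = Poly_Mapping.lookup m (\<pi> i)"
  by (simp add: map_key.rep_eq bij_is_inj)

lemma mono_deg_map_key:
  assumes "bij \<pi>"
  shows "mono_deg (Poly_Mapping.map_key \<pi> m) = mono_deg m"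
proof -
  have "\<pi> ` (\<pi> -` Poly_Mapping.keys m) = Poly_Mapping.keys m"
    using assms by (simp add: bij_is_surj surj_image_vimage_eq)
  moreover have "inj_on \<pi> (\<pi> -` Poly_Mapping.keys m)"
    using assms by (meson bij_is_inj inj_on_subset subset_UNIV)
  ultimately have "bij_betw \<pi> (\<pi> -` Poly_Mapping.keys m) (Poly_Mapping.keys m)"
    by (simp add: bij_betw_def)
  from sum.reindex_bij_betw[OF this, of "Poly_Mapping.lookup m"] show ?thesis
    using assms by (simp add: mono_deg_def keys_map_key_bij lookup_map_key_bij)
qed

lemma map_key_plus_bij:
  assumes "bij \<pi>"
  shows "Poly_Mapping.map_key \<pi> (a + b) = Poly_Mapping.map_key \<pi> a + Poly_Mapping.map_key \<pi> b"
  using assms by (intro poly_mapping_eqI) (simp add: lookup_map_key_bij lookup_add)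

lemma map_key_zero_bij: "bij \<pi> \<Longrightarrow> Poly_Mapping.map_key \<pi> 0 = 0"
  by (intro poly_mapping_eqI) (simp add: lookup_map_key_bij)

lemma map_key_inv_bij:
  assumes "bij \<pi>"
  shows "Poly_Mapping.map_key \<pi> (Poly_Mapping.map_key (inv \<pi>) m) = m"
    and "Poly_Mapping.map_key (inv \<pi>) (Poly_Mapping.map_key \<pi> m) = m"
  using assms
  by (auto intro!: poly_mapping_eqI
      simp: lookup_map_key_bij bij_imp_bij_inv bij_is_inj bij_is_surj surj_f_inv_f)

lemma finite_splits [simp]: "finite (splits m)"
proof -
  let ?D = "{a :: mono. \<forall>i. Poly_Mapping.lookup a i \<le> Poly_Mapping.lookup m i}"
  let ?F = "{f. \<forall>i. (i \<in> Poly_Mapping.keys m \<longrightarrow> f i \<in> {..mono_deg m}) \<and>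
                    (i \<notin> Poly_Mapping.keys m \<longrightarrow> f i = (0::nat))}"
  have "finite ?F"
    by (intro finite_set_of_finite_funs) auto
  moreover have "Poly_Mapping.lookup ` ?D \<subseteq> ?F"
  proof (intro subsetI CollectI allI conjI impI)
    fix f i assume "f \<in> Poly_Mapping.lookup ` ?D"
    then have *: "f i \<le> Poly_Mapping.lookup m i" by auto
    then show "f i \<in> {..mono_deg m}"
      using lookup_le_mono_deg[of m i] by simp
    show "f i = 0" if "i \<notin> Poly_Mapping.keys m"
      using * that by (simp add: in_keys_iff)
  qed
  ultimately have "finite (Poly_Mapping.lookup ` ?D)"
    by (rule finite_subset[rotated])
  then have "finite ?D"
    by (rule finite_imageD) (auto intro!: inj_onI poly_mapping_eqI)
  moreover have "splits m \<subseteq> ?D \<times> ?D"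
    by (auto simp: splits_def lookup_add)
  ultimately show ?thesis
    by (meson finite_SigmaI finite_subset)
qed

lemma splits_map_key:
  assumes "bij \<pi>"
  shows "bij_betw (map_prod (Poly_Mapping.map_key \<pi>) (Poly_Mapping.map_key \<pi>))
           (splits m) (splits (Poly_Mapping.map_key \<pi> m))"
  by (rule bij_betw_byWitness
      [where f' = "map_prod (Poly_Mapping.map_key (inv \<pi>)) (Poly_Mapping.map_key (inv \<pi>))"])
    (auto simp: splits_def map_key_plus_bij[OF assms, symmetric] map_key_inv_bij[OF assms]
      map_key_plus_bij[OF bij_imp_bij_inv[OF assms], symmetric])

typedef sym = "{f :: mono \<Rightarrow> rat. symmetric_series f \<and> bounded_degree f}"
  morphisms coeff_sym Abs_sym
  by (rule exI[of _ "\<lambda>_. 0"]) (auto simp: symmetric_series_def bounded_degree_def)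

setup_lifting type_definition_sym

instantiation sym :: comm_ring_1
begin

lift_definition zero_sym :: sym is "\<lambda>_. 0"
  by (auto simp: symmetric_series_def bounded_degree_def)

lift_definition one_sym :: sym is "\<lambda>m. if m = 0 then 1 else 0"
proof -
  have "Poly_Mapping.map_key \<pi> m = 0 \<longleftrightarrow> m = 0" if "bij \<pi>" for \<pi> :: "nat \<Rightarrow> nat" and m :: mono
    by (metis that bij_imp_bij_inv map_key_inv_bij(2) map_key_zero_bij)
  then show "symmetric_series (\<lambda>m. if m = 0 then 1 else 0) \<and> bounded_degree (\<lambda>m. if m = 0 then 1 else 0)"
    by (auto simp: symmetric_series_def bounded_degree_def intro!: exI[of _ 0])
qed

lift_definition plus_sym :: "sym \<Rightarrow> sym \<Rightarrow> sym" is "\<lambda>f g m. f m + g m"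
proof -
  fix f g :: "mono \<Rightarrow> rat"
  assume *: "symmetric_series f \<and> bounded_degree f" "symmetric_series g \<and> bounded_degree g"
  then obtain d d' where "\<forall>m. mono_deg m > d \<longrightarrow> f m = 0" "\<forall>m. mono_deg m > d' \<longrightarrow> g m = 0"
    by (auto simp: bounded_degree_def)
  then have "\<forall>m. mono_deg m > max d d' \<longrightarrow> f m + g m = 0"
    by auto
  then show "symmetric_series (\<lambda>m. f m + g m) \<and> bounded_degree (\<lambda>m. f m + g m)"
    using * unfolding symmetric_series_def bounded_degree_def by (intro conjI exI[of _ "max d d'"]) auto
qed

lift_definition uminus_sym :: "sym \<Rightarrow> sym" is "\<lambda>f m. - f m"
  by (auto simp: symmetric_series_def bounded_degree_def)

definition minus_sym :: "sym \<Rightarrow> sym \<Rightarrow> sym" where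
  "minus_sym f g = f + - g"

lift_definition times_sym :: "sym \<Rightarrow> sym \<Rightarrow> sym" is
  "\<lambda>f g m. \<Sum>(a, b)\<in>splits m. f a * g b"
proof -
  fix f g :: "mono \<Rightarrow> rat"
  assume *: "symmetric_series f \<and> bounded_degree f" "symmetric_series g \<and> bounded_degree g"
  let ?h = "\<lambda>m. \<Sum>(a, b)\<in>splits m. f a * g b"
  from * obtain d d' where d: "\<forall>m. mono_deg m > d \<longrightarrow> f m = 0" "\<forall>m. mono_deg m > d' \<longrightarrow> g m = 0"
    by (auto simp: bounded_degree_def)
  have "?h m = 0" if "mono_deg m > d + d'" for m
  proof (intro sum.neutral ballI, clarify)
    fix a b assume "(a, b) \<in> splits m"
    then have "mono_deg a + mono_deg b > d + d'"
      using that by (auto simp: splits_def mono_deg_plus)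
    then have "mono_deg a > d \<or> mono_deg b > d'"
      by linarith
    then show "f a * g b = 0"
      using d by auto
  qed
  then have "bounded_degree ?h"
    by (auto simp: bounded_degree_def)
  moreover have "?h (Poly_Mapping.map_key \<pi> m) = ?h m" if "bij \<pi>" for \<pi> m
    using sum.reindex_bij_betw[OF splits_map_key[OF that], of "\<lambda>(a, b). f a * g b" m] * that
    by (simp add: symmetric_series_def case_prod_unfold)
  ultimately show "symmetric_series ?h \<and> bounded_degree ?h"
    by (auto simp: symmetric_series_def)
qed

instance
proof
  fix f g h :: sym
  show "f * g * h = f * (g * h)"
  proof (transfer, rule ext)
    fix f g h :: "mono \<Rightarrow> rat" and m
    have "(\<Sum>(a, b)\<in>splits m. (\<Sum>(c, d)\<in>splits a. f c * g d) * h b)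
        = (\<Sum>x\<in>splits m. \<Sum>y\<in>splits (fst x). f (fst y) * g (snd y) * h (snd x))"
      by (simp add: case_prod_unfold sum_distrib_right)
    also have "\<dots> = (\<Sum>(x, y)\<in>(SIGMA x:splits m. splits (fst x)). f (fst y) * g (snd y) * h (snd x))"
      by (subst sum.Sigma) auto
    also have "\<dots> = (\<Sum>(x, y)\<in>(SIGMA x:splits m. splits (snd x)). f (fst x) * (g (fst y) * h (snd y)))"
      by (rule sum.reindex_bij_witness
          [where j = "\<lambda>((a, b), (c, d)). ((c, d + b), (d, b))"
             and i = "\<lambda>((a, b), (c, d)). ((a + c, d), (a, c))"])
        (auto simp: splits_def add.assoc mult.assoc)
    also have "\<dots> = (\<Sum>x\<in>splits m. \<Sum>y\<in>splits (snd x). f (fst x) * (g (fst y) * h (snd y)))"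
      by (subst sum.Sigma) auto
    also have "\<dots> = (\<Sum>(a, b)\<in>splits m. f a * (\<Sum>(c, d)\<in>splits b. g c * h d))"
      by (simp add: case_prod_unfold sum_distrib_left)
    finally show "(\<Sum>(a, b)\<in>splits m. (\<Sum>(c, d)\<in>splits a. f c * g d) * h b)
        = (\<Sum>(a, b)\<in>splits m. f a * (\<Sum>(c, d)\<in>splits b. g c * h d))" .
  qed
  show "f * g = g * f"
  proof (transfer, rule ext)
    fix f g :: "mono \<Rightarrow> rat" and m
    show "(\<Sum>(a, b)\<in>splits m. f a * g b) = (\<Sum>(a, b)\<in>splits m. g a * f b)"
      by (rule sum.reindex_bij_witness[where i = prod.swap and j = prod.swap])
        (auto simp: splits_def add.commute mult.commute)
  qed
  show "1 * f = f"
  proof (transfer, rule ext)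
    fix f :: "mono \<Rightarrow> rat" and m
    have "(\<Sum>(a, b)\<in>splits m. (if a = 0 then 1 else 0) * f b)
        = (\<Sum>(a, b)\<in>{(0 :: mono, m)}. (if a = 0 then 1 else 0) * f b)"
      by (rule sum.mono_neutral_right[OF finite_splits]) (auto simp: splits_def split: if_splits)
    then show "(\<Sum>(a, b)\<in>splits m. (if a = 0 then 1 else 0) * f b) = f m"
      by simp
  qed
  show "(f + g) * h = f * h + g * h"
    by transfer (auto simp: algebra_simps sum.distrib case_prod_unfold)
  show "f + g + h = f + (g + h)" "f + g = g + f" "0 + f = f" "- f + f = 0"
    by (transfer; simp add: algebra_simps)+
  show "f - g = f + - g"
    by (simp add: minus_sym_def)
  show "(0::sym) \<noteq> 1"
    by transfer (metis zero_neq_one)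
qed

end

lift_definition sym_scale :: "rat \<Rightarrow> sym \<Rightarrow> sym" is "\<lambda>c f m. c * f m"
  by (auto simp: symmetric_series_def bounded_degree_def)

lemma vector_space_sym_scale: "vector_space sym_scale"
  by unfold_locales (transfer; simp add: algebra_simps)+

lemma sym_scale_mult: "sym_scale c (f * g) = sym_scale c f * g"
  by transfer (simp add: sum_distrib_left case_prod_unfold mult.assoc)


section \<open>Standard symmetric functions\<close>

lift_definition sym_h :: "nat \<Rightarrow> sym" is "\<lambda>k m. if mono_deg m = k then 1 else 0"
  by (auto simp: symmetric_series_def bounded_degree_def mono_deg_map_key)

lift_definition sym_e :: "nat \<Rightarrow> sym" is
  "\<lambda>k m. if mono_deg m = k \<and> (\<forall>i. Poly_Mapping.lookup m i \<le> 1) then 1 else 0"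
proof -
  fix k :: nat
  have "(\<forall>i. Poly_Mapping.lookup m (\<pi> i) \<le> 1) \<longleftrightarrow> (\<forall>i. Poly_Mapping.lookup m i \<le> 1)"
    if "bij \<pi>" for \<pi> and m :: mono
    using that by (metis bij_pointE)
  then show "symmetric_series (\<lambda>m. if mono_deg m = k \<and> (\<forall>i. Poly_Mapping.lookup m i \<le> 1) then 1 else 0)
      \<and> bounded_degree (\<lambda>m. if mono_deg m = k \<and> (\<forall>i. Poly_Mapping.lookup m i \<le> 1) then 1 else 0)"
    by (auto simp: symmetric_series_def bounded_degree_def mono_deg_map_key lookup_map_key_bij)
qed

text \<open>Only meant for \<open>k \<ge> 1\<close>; at \<open>k = 0\<close> this is the constant 1.\<close>

lift_definition sym_p :: "nat \<Rightarrow> sym" is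
  "\<lambda>k m. if \<exists>i. m = Poly_Mapping.single i k then 1 else 0"
proof -
  fix k :: nat
  have *: "\<exists>i. Poly_Mapping.map_key \<pi> m = Poly_Mapping.single i k"
    if "bij \<pi>" "\<exists>i. m = Poly_Mapping.single i k" for \<pi> :: "nat \<Rightarrow> nat" and m
  proof -
    from that obtain i where i: "m = Poly_Mapping.single i k" by auto
    have "Poly_Mapping.map_key \<pi> m = Poly_Mapping.single (inv \<pi> i) k"
      using that(1) unfolding i
      by (intro poly_mapping_eqI)
        (auto simp: lookup_map_key_bij lookup_single when_def bij_is_inj surj_f_inv_f[OF bij_is_surj])
    then show ?thesis by auto
  qed
  then have "(\<exists>i. Poly_Mapping.map_key \<pi> m = Poly_Mapping.single i k) \<longleftrightarrow> (\<exists>i. m = Poly_Mapping.single i k)"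
    if "bij \<pi>" for \<pi> :: "nat \<Rightarrow> nat" and m :: mono
    using that *[OF bij_imp_bij_inv[OF that], of "Poly_Mapping.map_key \<pi> m"]
    by (metis map_key_inv_bij(2))
  then show "symmetric_series (\<lambda>m. if \<exists>i. m = Poly_Mapping.single i k then 1 else 0)
      \<and> bounded_degree (\<lambda>m. if \<exists>i. m = Poly_Mapping.single i k then 1 else 0)"
    by (auto simp: symmetric_series_def bounded_degree_def intro!: exI[of _ k])
qed

definition sym_P :: "nat \<Rightarrow> sym" where
  "sym_P k = (if k = 0 then 1 else sym_scale (1/2) (\<Sum>i=0..k. sym_h i * sym_e (k - i)))"

definition sym_R :: "nat \<Rightarrow> sym" where
  "sym_R m = (if odd m then sym_P m else (\<Sum>i=1..m div 2. sym_P (2 * i) * sym_P (m - 2 * i)))"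

text \<open>Partitions are represented by the multiset of their parts.\<close>

definition h_part :: "nat multiset \<Rightarrow> sym" where
  "h_part l = (\<Prod>k\<in>#l. sym_h k)"

definition R_part :: "nat multiset \<Rightarrow> sym" where
  "R_part l = (\<Prod>k\<in>#l. sym_R k)"

definition sym_alg_endo :: "(sym \<Rightarrow> sym) \<Rightarrow> bool" where
  "sym_alg_endo \<phi> \<longleftrightarrow> Vector_Spaces.linear sym_scale sym_scale \<phi> \<and>
     \<phi> 1 = 1 \<and> (\<forall>f g. \<phi> (f * g) = \<phi> f * \<phi> g)"

text \<open>
  The power sums \<open>sym_p k\<close>, \<open>k \<ge> 1\<close>, freely generate the rational algebra \<open>sym\<close>, so exactly one
  function satisfies the following predicate.
\<close>

definition is_sh :: "(sym \<Rightarrow> sym) \<Rightarrow> bool" where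
  "is_sh sh \<longleftrightarrow> sym_alg_endo sh \<and>
     (\<forall>k\<ge>1. sh (sym_p (2 * k - 1)) = sym_scale 2 (sym_p (2 * k - 1)) \<and> sh (sym_p (2 * k)) = 0)"


section \<open>Parking functions and garages\<close>

text \<open>An \<open>n\<close>-tuple is a list of length \<open>n\<close>, so its \<open>k\<close>-th entry is the list element at index \<open>k - 1\<close>.\<close>

definition Pf :: "nat \<Rightarrow> nat list set" where
  "Pf n = {p. length p = n \<and> (\<forall>x\<in>set p. x \<ge> 1) \<and> (\<forall>i\<in>{1..n}. sort p ! (i - 1) \<le> i)}"

definition alpha :: "nat list \<Rightarrow> nat \<Rightarrow> nat" where
  "alpha p k = card {j \<in> {1..length p}. p ! (j - 1) = k}"

definition lam :: "nat list \<Rightarrow> nat multiset" where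
  "lam p = image_mset (alpha p) (mset_set {k. alpha p k \<noteq> 0})"

definition PF :: "nat \<Rightarrow> sym" where
  "PF n = (\<Sum>p\<in>{p \<in> Pf n. sorted p}. h_part (lam p))"

definition naive_shifted_pf :: "nat \<Rightarrow> (nat list \<times> int list) set" where
  "naive_shifted_pf n = {(p, \<sigma>). p \<in> Pf n \<and> sorted p \<and> length \<sigma> = n \<and> set \<sigma> \<subseteq> {-1, 0, 1} \<and>
     (\<forall>k\<in>{1..n}. \<sigma> ! (k - 1) = 0 \<longleftrightarrow> alpha p k = 0)}"

definition upsilon :: "nat list \<Rightarrow> nat \<Rightarrow> nat" where
  "upsilon p i = (if alpha p i = 0 then 0 else if odd (alpha p i) then 1 else 2)"

definition Gar :: "nat \<Rightarrow> (nat list \<times> int list) set" where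
  "Gar n = {(p, \<sigma>) \<in> naive_shifted_pf n.
     \<forall>i\<in>{1..n}. \<forall>j\<in>{1..n}. i < j \<and> upsilon p i = 2 \<and> upsilon p j = 2 \<and>
       (\<forall>w. prefix w (map (upsilon p) [i + 1..<j]) \<longrightarrow> count_list w 2 \<ge> count_list w 0)
       \<longrightarrow> \<sigma> ! (i - 1) = \<sigma> ! (j - 1)}"

lemma finite_Pf: "finite (Pf n)"
proof -
  have "Pf n \<subseteq> {p. set p \<subseteq> {..n} \<and> length p = n}"
  proof (intro subsetI CollectI conjI)
    fix p x assume p: "p \<in> Pf n"
    then show "length p = n" by (simp add: Pf_def)
    assume "x \<in> set p"
    then have "x \<in> set (sort p)" by simp
    then obtain i where "i < n" "sort p ! i = x"
      using p by (metis (mono_tags, lifting) Pf_def in_set_conv_nth length_sort mem_Collect_eq)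
    then show "x \<in> {..n}"
      using p by (auto simp: Pf_def dest!: bspec[of _ _ "Suc i"])
  qed
  then show ?thesis
    using finite_lists_length_eq[of "{..n}" n] by (rule finite_subset) auto
qed

lemma finite_Gar: "finite (Gar n)"
proof -
  have "Gar n \<subseteq> Pf n \<times> {\<sigma>. set \<sigma> \<subseteq> {-1, 0, 1} \<and> length \<sigma> = n}"
    by (auto simp: Gar_def naive_shifted_pf_def)
  then show ?thesis
    using finite_Pf finite_lists_length_eq[of "{-1, 0, 1 :: int}" n]
    by (meson finite.emptyI finite.insertI finite_SigmaI finite_subset)
qed

lemma finite_alpha_support: "finite {k. alpha p k \<noteq> 0}"
proof (rule finite_subset)
  show "{k. alpha p k \<noteq> 0} \<subseteq> set p"
  proof clarify
    fix k assume "0 < alpha p k"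
    then obtain j where "j \<in> {1..length p}" "p ! (j - 1) = k"
      unfolding alpha_def by (metis (mono_tags, lifting) card_gt_0_iff ex_in_conv mem_Collect_eq)
    then show "k \<in> set p" by (auto simp: in_set_conv_nth intro!: exI[of _ "j - 1"])
  qed
qed simp

end

theory Submission
  imports Defs "HOL-Computational_Algebra.Formal_Power_Series"
begin

text \<open>
  The series \<open>q\<^sub>k = \<Sum>\<^sub>i h\<^sub>i e\<^bsub>k - i\<^esub>\<close> has coefficient \<open>2\<^sup>r\<close> at a monomial of degree \<open>k\<close> in \<open>r\<close> variables,
  hence satisfies \<open>n q\<^sub>n = \<Sum> 2 p\<^sub>i q\<^bsub>n - i\<^esub>\<close> over odd \<open>i\<close>, and therefore \<open>sh(h\<^sub>k) = q\<^sub>k\<close>. So with \<open>w\<close> ranging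
  over the content words of sorted parking functions (Lukasiewicz words), \<open>SH\<^sub>n\<close> is the sum of the
  products of the \<open>q\<^bsub>w\<^sub>k\<^esub>\<close>. On the garage side the signs of a word are counted by reading it from left
  to right with a counter \<open>d\<close> of nonzero even letters not yet closed by a \<open>0\<close>: an odd letter has two signs,
  an even letter has two signs if \<open>d = 0\<close> and otherwise the sign of the open ones.

  Let \<open>y(t) = \<Sum>\<^sub>i P\<^bsub>2i\<^esub> t\<^bsup>2i\<^esup>\<close>, \<open>x = 1/y\<close>, \<open>a(t) = \<Sum> 2 R\<^sub>m t\<^sup>m\<close> over odd \<open>m\<close> and \<open>b(t) = \<Sum> R\<^sub>m t\<^sup>m\<close>
  over even \<open>m > 0\<close>. The definition of \<open>R\<close> says \<open>b = (y - 1) y\<close>, and \<open>q(t) = \<Sum>\<^sub>k q\<^sub>k t\<^sup>k = a + 2 y - 1\<close>. Hence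
  \<open>x\<^sup>d\<close> is an eigenvector, with eigenvalue \<open>q\<close>, of the transfer operator of the counter:
  \<open>1 + a + 2 b x = q\<close> and \<open>x\<^bsup>d - 1\<^esup> + a x\<^sup>d + b x\<^bsup>d + 1\<^esup> = q x\<^sup>d\<close> for \<open>d > 0\<close>. If \<open>T = z q(T)\<close>, it
  follows that the words that first descend by \<open>h\<close> at their end, read with initial counter
  \<open>d \<le> h\<close>, have generating function \<open>T\<^sup>h x(T)\<^sup>d\<close> on the garage side; for \<open>d = 0\<close> this is \<open>T\<^sup>h\<close>, the
  generating function of the products of the \<open>q\<^sub>k\<close>.
\<close>

section \<open>Newton identities and the image of the complete symmetric functions\<close>

interpretation sym_scale: vector_space sym_scale
  by (rule vector_space_sym_scale)

lemma sym_eqI: "(\<And>m. coeff_sym f m = coeff_sym g m) \<Longrightarrow> f = g"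
  by (simp add: coeff_sym_inject[symmetric] fun_eq_iff)

lemma coeff_sym_sum: "coeff_sym (\<Sum>x\<in>A. f x) m = (\<Sum>x\<in>A. coeff_sym (f x) m)"
  by (induction A rule: infinite_finite_induct) (simp_all add: zero_sym.rep_eq plus_sym.rep_eq)

lemma single_plus_minus_single:
  fixes m :: mono
  assumes "i \<le> Poly_Mapping.lookup m j"
  shows "Poly_Mapping.single j i + (m - Poly_Mapping.single j i) = m"
  using assms by (intro poly_mapping_eqI) (auto simp: lookup_add lookup_minus lookup_single when_def)

lemma mono_deg_minus_single:
  assumes "i \<le> Poly_Mapping.lookup m j"
  shows "mono_deg (m - Poly_Mapping.single j i) = mono_deg m - i"
  using arg_cong[OF single_plus_minus_single[OF assms], of mono_deg] by (simp add: mono_deg_plus)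

lemma mono_deg_eq_0_iff: "mono_deg m = 0 \<longleftrightarrow> m = 0"
  by (metis le_zero_eq lookup_le_mono_deg lookup_zero mono_deg_zero poly_mapping_eqI)

lemma splits_single_left:
  assumes "i > 0"
  shows "{(a, b) \<in> splits m. \<exists>j. a = Poly_Mapping.single j i} =
    (\<lambda>j. (Poly_Mapping.single j i, m - Poly_Mapping.single j i)) `
      {j \<in> Poly_Mapping.keys m. i \<le> Poly_Mapping.lookup m j}"
proof -
  have "j \<in> Poly_Mapping.keys m \<and> i \<le> Poly_Mapping.lookup m j \<and> b = m - Poly_Mapping.single j i"
    if "Poly_Mapping.single j i + b = m" for j b
    using assms that by (auto simp: in_keys_iff lookup_add)
  then show ?thesis
    using single_plus_minus_single by (fastforce simp: splits_def)
qed

lemma coeff_sym_p_mult: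
  assumes "i > 0"
  shows "coeff_sym (sym_p i * f) m =
    (\<Sum>j | j \<in> Poly_Mapping.keys m \<and> i \<le> Poly_Mapping.lookup m j.
       coeff_sym f (m - Poly_Mapping.single j i))"
proof -
  let ?J = "{j \<in> Poly_Mapping.keys m. i \<le> Poly_Mapping.lookup m j}"
  have "coeff_sym (sym_p i * f) m =
      (\<Sum>s\<in>splits m. if \<exists>j. fst s = Poly_Mapping.single j i then coeff_sym f (snd s) else 0)"
    unfolding times_sym.rep_eq sym_p.rep_eq by (intro sum.cong) auto
  also have "\<dots> = (\<Sum>s\<in>{(a, b) \<in> splits m. \<exists>j. a = Poly_Mapping.single j i}. coeff_sym f (snd s))"
    by (simp add: case_prod_unfold flip: sum.inter_filter)
  also have "\<dots> = (\<Sum>j\<in>?J. coeff_sym f (m - Poly_Mapping.single j i))"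
    unfolding splits_single_left[OF assms]
  proof (subst sum.reindex)
    show "inj_on (\<lambda>j. (Poly_Mapping.single j i, m - Poly_Mapping.single j i)) ?J"
      using assms by (intro inj_onI) (metis lookup_single_eq lookup_single_not_eq not_gr_zero prod.inject)
  qed simp
  finally show ?thesis .
qed

text \<open>
  Multiplication by a power sum lowers one exponent of a monomial, so a recurrence of Newton's
  type may be verified one variable at a time.
\<close>

lemma newton_identityI:
  assumes homogeneous: "\<And>k m. mono_deg m \<noteq> k \<Longrightarrow> coeff_sym (f k) m = 0"
    and exponent: "\<And>m j. mono_deg m = n \<Longrightarrow> j \<in> Poly_Mapping.keys m \<Longrightarrow>
      (\<Sum>i=1..Poly_Mapping.lookup m j. c i * coeff_sym (f (n - i)) (m - Poly_Mapping.single j i)) =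
        of_nat (Poly_Mapping.lookup m j) * coeff_sym (f n) m"
  shows "sym_scale (of_nat n) (f n) = (\<Sum>i=1..n. sym_scale (c i) (sym_p i) * f (n - i))"
proof (rule sym_eqI)
  fix m :: mono
  let ?l = "Poly_Mapping.lookup m"
  let ?g = "\<lambda>i j. c i * coeff_sym (f (n - i)) (m - Poly_Mapping.single j i)"
  have coeff_rhs: "coeff_sym (\<Sum>i=1..n. sym_scale (c i) (sym_p i) * f (n - i)) m =
      (\<Sum>i=1..n. \<Sum>j | j \<in> Poly_Mapping.keys m \<and> i \<le> ?l j. ?g i j)"
    by (simp add: coeff_sym_sum sym_scale.rep_eq coeff_sym_p_mult sum_distrib_left
        flip: sym_scale_mult)
  show "coeff_sym (sym_scale (of_nat n) (f n)) m =
      coeff_sym (\<Sum>i=1..n. sym_scale (c i) (sym_p i) * f (n - i)) m"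
  proof (cases "mono_deg m = n")
    case True
    have "(\<Sum>i=1..n. \<Sum>j | j \<in> Poly_Mapping.keys m \<and> i \<le> ?l j. ?g i j) =
        (\<Sum>j\<in>Poly_Mapping.keys m. \<Sum>i | i \<in> {1..n} \<and> i \<le> ?l j. ?g i j)"
      by (rule sum.swap_restrict) auto
    also have "\<dots> = (\<Sum>j\<in>Poly_Mapping.keys m. \<Sum>i=1..?l j. ?g i j)"
      using lookup_le_mono_deg[of m] True by (intro sum.cong refl) (auto intro: order_trans)
    also have "\<dots> = (\<Sum>j\<in>Poly_Mapping.keys m. of_nat (?l j) * coeff_sym (f n) m)"
      using exponent[OF True] by (intro sum.cong refl)
    also have "\<dots> = of_nat n * coeff_sym (f n) m"
      unfolding sum_distrib_right[symmetric] of_nat_sum[symmetric]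
      using True by (simp add: mono_deg_def)
    finally show ?thesis
      unfolding coeff_rhs by (simp add: sym_scale.rep_eq)
  next
    case False
    have "coeff_sym (f (n - i)) (m - Poly_Mapping.single j i) = 0" if "i \<in> {1..n}" "i \<le> ?l j" for i j
      using that False lookup_le_mono_deg[of m j]
      by (intro homogeneous) (auto simp: mono_deg_minus_single)
    then have "(\<Sum>i=1..n. \<Sum>j | j \<in> Poly_Mapping.keys m \<and> i \<le> ?l j. ?g i j) = 0"
      by (intro sum.neutral ballI) auto
    then show ?thesis
      unfolding coeff_rhs using False by (simp add: sym_scale.rep_eq homogeneous)
  qed
qed

lemma newton_h: "sym_scale (of_nat n) (sym_h n) = (\<Sum>i=1..n. sym_p i * sym_h (n - i))"
proof -
  have "sym_scale (of_nat n) (sym_h n) = (\<Sum>i=1..n. sym_scale 1 (sym_p i) * sym_h (n - i))"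
    by (rule newton_identityI) (simp_all add: sym_h.rep_eq mono_deg_minus_single)
  then show ?thesis by simp
qed

definition sym_Q :: "nat \<Rightarrow> sym" where
  "sym_Q n = (\<Sum>i=0..n. sym_h i * sym_e (n - i))"

lemma card_splits_squarefree:
  "card {(a, b) \<in> splits m. \<forall>i. Poly_Mapping.lookup b i \<le> 1} = 2 ^ card (Poly_Mapping.keys m)"
proof -
  let ?D = "{(a, b) \<in> splits m. \<forall>i. Poly_Mapping.lookup b i \<le> 1}"
  define ind :: "nat set \<Rightarrow> mono" where "ind S = (\<Sum>i\<in>S. Poly_Mapping.single i 1)" for S
  have lookup_ind: "Poly_Mapping.lookup (ind S) i = (if i \<in> S then 1 else 0)"
    if "S \<subseteq> Poly_Mapping.keys m" for S i
    using finite_subset[OF that] by (simp add: ind_def lookup_sum lookup_single when_def)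
  have "bij_betw (\<lambda>(a, b). Poly_Mapping.keys b) ?D (Pow (Poly_Mapping.keys m))"
  proof (rule bij_betw_byWitness[where f' = "\<lambda>S. (m - ind S, ind S)"])
    have "ind (Poly_Mapping.keys b) = b" if "(a, b) \<in> ?D" for a b
    proof (rule poly_mapping_eqI)
      fix i
      have "Poly_Mapping.keys b \<subseteq> Poly_Mapping.keys m"
        using that by (auto simp: splits_def in_keys_iff lookup_add)
      moreover have "Poly_Mapping.lookup b i \<le> 1"
        using that by simp
      ultimately show "Poly_Mapping.lookup (ind (Poly_Mapping.keys b)) i = Poly_Mapping.lookup b i"
        by (auto simp: lookup_ind in_keys_iff)
    qed
    then show "\<forall>s\<in>?D. (\<lambda>S. (m - ind S, ind S)) ((\<lambda>(a, b). Poly_Mapping.keys b) s) = s"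
      by (auto simp: splits_def)
    show "\<forall>S\<in>Pow (Poly_Mapping.keys m). (\<lambda>(a, b). Poly_Mapping.keys b) (m - ind S, ind S) = S"
      by (auto simp: in_keys_iff lookup_ind split: if_splits)
    show "(\<lambda>(a, b). Poly_Mapping.keys b) ` ?D \<subseteq> Pow (Poly_Mapping.keys m)"
      by (auto simp: splits_def in_keys_iff lookup_add)
    have "m - ind S + ind S = m" if "S \<subseteq> Poly_Mapping.keys m" for S
      using that by (intro poly_mapping_eqI) (auto simp: lookup_add lookup_minus lookup_ind in_keys_iff)
    then show "(\<lambda>S. (m - ind S, ind S)) ` Pow (Poly_Mapping.keys m) \<subseteq> ?D"
      by (auto simp: splits_def lookup_ind)
  qed
  then show ?thesis
    by (simp add: bij_betw_same_card card_Pow)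
qed

lemma coeff_sym_Q:
  "coeff_sym (sym_Q n) m = (if mono_deg m = n then 2 ^ card (Poly_Mapping.keys m) else 0)"
proof -
  let ?sf = "\<lambda>b. \<forall>i. Poly_Mapping.lookup b i \<le> 1"
  have "coeff_sym (sym_Q n) m = (\<Sum>i=0..n. \<Sum>(a, b)\<in>splits m.
      if mono_deg a = i \<and> mono_deg b = n - i \<and> ?sf b then 1 else 0)"
    unfolding sym_Q_def coeff_sym_sum times_sym.rep_eq sym_h.rep_eq sym_e.rep_eq
    by (intro sum.cong refl) auto
  also have "\<dots> = (\<Sum>(a, b)\<in>splits m. \<Sum>i=0..n.
      if mono_deg a = i \<and> mono_deg b = n - i \<and> ?sf b then 1 else 0)"
    by (subst sum.swap) (simp add: case_prod_unfold)
  also have "\<dots> = (\<Sum>(a, b)\<in>splits m. if mono_deg m = n \<and> ?sf b then 1 else 0)"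
  proof (intro sum.cong refl, clarify)
    fix a b assume "(a, b) \<in> splits m"
    then have deg: "mono_deg a + mono_deg b = mono_deg m"
      by (auto simp: splits_def mono_deg_plus)
    have "(\<Sum>i=0..n. if mono_deg a = i \<and> mono_deg b = n - i \<and> ?sf b then 1 else 0 :: rat) =
        (\<Sum>i=0..n. if i = mono_deg a then (if mono_deg b = n - i \<and> ?sf b then 1 else 0) else 0)"
      by (intro sum.cong refl) auto
    also have "\<dots> = (if mono_deg m = n \<and> ?sf b then 1 else 0)"
      using deg by (auto simp: sum.delta)
    finally show "(\<Sum>i=0..n. if mono_deg a = i \<and> mono_deg b = n - i \<and> ?sf b then 1 else 0 :: rat) =
        (if mono_deg m = n \<and> ?sf b then 1 else 0)" .
  qed
  also have "\<dots> = (if mono_deg m = n then of_nat (card {(a, b) \<in> splits m. ?sf b}) else 0)"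
    by (simp add: case_prod_unfold flip: sum.inter_filter)
  finally show ?thesis
    by (simp only: card_splits_squarefree of_nat_power of_nat_numeral)
qed

lemma keys_minus_single:
  fixes m :: mono
  shows "Poly_Mapping.keys (m - Poly_Mapping.single j i) =
    (if Poly_Mapping.lookup m j \<le> i then Poly_Mapping.keys m - {j} else Poly_Mapping.keys m)"
  by (auto simp: in_keys_iff lookup_minus lookup_single when_def split: if_splits)

lemma newton_Q:
  "sym_scale (of_nat n) (sym_Q n) =
    (\<Sum>i=1..n. sym_scale (if odd i then 2 else 0) (sym_p i) * sym_Q (n - i))"
proof (rule newton_identityI)
  fix m :: mono and j
  assume deg: "mono_deg m = n" and key: "j \<in> Poly_Mapping.keys m"
  let ?c = "\<lambda>i. if odd i then 2 else 0 :: rat" and ?K = "card (Poly_Mapping.keys m)"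
  let ?g = "\<lambda>i. ?c i * coeff_sym (sym_Q (n - i)) (m - Poly_Mapping.single j i)"
  obtain l where lookup: "Poly_Mapping.lookup m j = Suc l"
    using key by (auto simp: in_keys_iff gr0_conv_Suc)
  have sum_c: "(\<Sum>i=1..k. ?c i) = of_nat k + (if odd k then 1 else 0)" for k
    by (induction k) auto
  have "?g i = ?c i * 2 ^ ?K" if "i \<in> {1..l}" for i
    using that lookup deg by (simp add: coeff_sym_Q mono_deg_minus_single keys_minus_single)
  then have "(\<Sum>i=1..l. ?g i) = (\<Sum>i=1..l. ?c i) * 2 ^ ?K"
    unfolding sum_distrib_right by (intro sum.cong refl)
  moreover have "?g (Suc l) = (if odd (Suc l) then 2 ^ ?K else 0)"
  proof -
    have "?K = Suc (card (Poly_Mapping.keys m - {j}))"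
      using card_Suc_Diff1[OF finite_keys key] by simp
    then show ?thesis
      using lookup deg by (simp add: coeff_sym_Q mono_deg_minus_single keys_minus_single)
  qed
  ultimately have "(\<Sum>i=1..Suc l. ?g i) = of_nat (Suc l) * 2 ^ ?K"
    unfolding sum_c by (simp add: algebra_simps)
  then show "(\<Sum>i=1..Poly_Mapping.lookup m j. ?g i) =
      of_nat (Poly_Mapping.lookup m j) * coeff_sym (sym_Q n) m"
    using deg by (simp only: lookup coeff_sym_Q simp_thms if_True)
qed (simp add: coeff_sym_Q)

lemma sym_h_0: "sym_h 0 = 1"
  by (rule sym_eqI) (simp add: sym_h.rep_eq one_sym.rep_eq mono_deg_eq_0_iff)

lemma sym_Q_0 [simp]: "sym_Q 0 = 1"
  by (rule sym_eqI) (simp add: coeff_sym_Q one_sym.rep_eq mono_deg_eq_0_iff)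

lemma sym_P_0 [simp]: "sym_P 0 = 1"
  by (simp add: sym_P_def)

lemma sym_Q_eq_double_sym_P:
  assumes "k > 0"
  shows "sym_Q k = 2 * sym_P k"
proof -
  have "sym_P k = sym_scale (1/2) (sym_Q k)"
    using assms by (simp add: sym_P_def sym_Q_def)
  then show ?thesis
    by (simp add: mult_2 flip: sym_scale.scale_left_distrib)
qed

lemma sym_alg_endo_prod_mset:
  assumes "sym_alg_endo \<phi>"
  shows "\<phi> (\<Prod>x\<in>#M. f x) = (\<Prod>x\<in>#M. \<phi> (f x))"
  using assms by (induction M) (simp_all add: sym_alg_endo_def)

lemma sh_sym_p:
  assumes "is_sh sh" "i > 0"
  shows "sh (sym_p i) = sym_scale (if odd i then 2 else 0) (sym_p i)"
proof (cases "even i")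
  case True
  then obtain k where "i = 2 * k" by blast
  then show ?thesis using assms by (simp add: is_sh_def)
next
  case False
  then obtain k where "i = 2 * k + 1" using oddE by blast
  then have "i = 2 * (k + 1) - 1" by simp
  then show ?thesis using False assms by (auto simp: is_sh_def)
qed

lemma sh_sym_h:
  assumes "is_sh sh"
  shows "sh (sym_h n) = sym_Q n"
proof (induction n rule: less_induct)
  case (less n)
  interpret sh: Vector_Spaces.linear sym_scale sym_scale sh
    using assms by (simp add: is_sh_def sym_alg_endo_def)
  have sh_mult: "sh (f * g) = sh f * sh g" and sh_one: "sh 1 = 1" for f g
    using assms by (simp_all add: is_sh_def sym_alg_endo_def)
  show ?case
  proof (cases "n = 0")
    case True
    then show ?thesis by (simp add: sym_h_0 sh_one)
  next
    case False
    have "sym_scale (of_nat n) (sh (sym_h n)) = (\<Sum>i=1..n. sh (sym_p i) * sh (sym_h (n - i)))"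
      by (simp only: newton_h sh.sum sh_mult flip: sh.scale)
    also have "\<dots> = (\<Sum>i=1..n. sym_scale (if odd i then 2 else 0) (sym_p i) * sym_Q (n - i))"
      using assms less.IH by (intro sum.cong refl arg_cong2[where f = times]) (auto simp: sh_sym_p)
    also have "\<dots> = sym_scale (of_nat n) (sym_Q n)"
      by (rule newton_Q[symmetric])
    finally show ?thesis
      using False by simp
  qed
qed

lemma sh_h_part:
  assumes "is_sh sh"
  shows "sh (h_part l) = (\<Prod>k\<in>#l. sym_Q k)"
  using assms by (simp add: h_part_def sym_alg_endo_prod_mset sh_sym_h is_sh_def)

section \<open>Counting the signs of a word\<close>

definition letter_type :: "nat \<Rightarrow> nat" where
  "letter_type a = (if a = 0 then 0 else if odd a then 1 else 2)"

definition ballot :: "nat \<Rightarrow> nat list \<Rightarrow> bool" where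
  "ballot c u \<longleftrightarrow> (\<forall>v. prefix v u \<longrightarrow> count_list v 0 \<le> count_list v 2 + c)"

lemma ballot_Nil: "ballot c []"
  by (simp add: ballot_def)

lemma ballot_Cons:
  "ballot c (x # u) \<longleftrightarrow> (if x = 0 then c > 0 \<and> ballot (c - 1) u
     else if x = 2 then ballot (Suc c) u else ballot c u)"
proof -
  have "ballot c (x # u) \<longleftrightarrow>
      (\<forall>v. prefix v u \<longrightarrow> count_list (x # v) 0 \<le> count_list (x # v) 2 + c)"
    by (auto simp: ballot_def prefix_Cons)
  then show ?thesis
    by (cases c) (auto simp: ballot_def intro: exI[of _ "[]"])
qed

lemma ballot_mono: "ballot c u \<Longrightarrow> c \<le> c' \<Longrightarrow> ballot c' u"
  by (fastforce simp: ballot_def)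

definition garage_signs :: "nat list \<Rightarrow> int list \<Rightarrow> bool" where
  "garage_signs w \<sigma> \<longleftrightarrow> length \<sigma> = length w \<and>
     (\<forall>i<length w. \<sigma> ! i \<in> {-1, 0, 1} \<and> (\<sigma> ! i = 0 \<longleftrightarrow> w ! i = 0)) \<and>
     (\<forall>i<length w. \<forall>j<length w. i < j \<and> letter_type (w ! i) = 2 \<and> letter_type (w ! j) = 2 \<and>
        ballot 0 (map letter_type (take (j - Suc i) (drop (Suc i) w))) \<longrightarrow> \<sigma> ! i = \<sigma> ! j)"

text \<open>
  A nonzero even letter is open until the first later prefix with more \<open>0\<close>s than even letters;
  \<open>open_signs d s w \<sigma>\<close> is the condition that \<open>d\<close> open letters of sign \<open>s\<close> before \<open>w\<close> impose on
  the signs \<open>\<sigma>\<close> of \<open>w\<close>.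
\<close>

definition open_signs :: "nat \<Rightarrow> int \<Rightarrow> nat list \<Rightarrow> int list \<Rightarrow> bool" where
  "open_signs d s w \<sigma> \<longleftrightarrow> (\<forall>j<length w. d > 0 \<and> letter_type (w ! j) = 2 \<and>
     ballot (d - 1) (map letter_type (take j w)) \<longrightarrow> s = \<sigma> ! j)"

lemma open_signs_0: "open_signs 0 s w \<sigma>"
  by (simp add: open_signs_def)

lemma open_signs_antimono: "open_signs d s w \<sigma> \<Longrightarrow> d' \<le> d \<Longrightarrow> open_signs d' s w \<sigma>"
  unfolding open_signs_def by (meson diff_le_mono ballot_mono less_le_trans)

lemma open_signs_Cons:
  "open_signs d s (a # w) (t # \<sigma>) \<longleftrightarrow>
    (if a = 0 then open_signs (d - 1) s w \<sigma> else if odd a then open_signs d s w \<sigma>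
     else d > 0 \<longrightarrow> s = t \<and> open_signs (Suc d) s w \<sigma>)"
proof -
  have "open_signs d s (a # w) (t # \<sigma>) \<longleftrightarrow> (d > 0 \<and> letter_type a = 2 \<longrightarrow> s = t) \<and>
    (\<forall>j<length w. d > 0 \<and> letter_type (w ! j) = 2 \<and>
       ballot (d - 1) (letter_type a # map letter_type (take j w)) \<longrightarrow> s = \<sigma> ! j)"
    by (simp add: open_signs_def All_less_Suc2 ballot_Nil)
  then show ?thesis
    by (cases "d = 0") (auto simp: ballot_Cons letter_type_def open_signs_def)
qed

lemma garage_signs_Cons:
  "garage_signs (a # w) (t # \<sigma>) \<longleftrightarrow> t \<in> {-1, 0, 1} \<and> (t = 0 \<longleftrightarrow> a = 0) \<and>
     (letter_type a = 2 \<longrightarrow> open_signs 1 t w \<sigma>) \<and> garage_signs w \<sigma>"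
  by (auto simp: garage_signs_def open_signs_def All_less_Suc2)

definition signings :: "nat \<Rightarrow> int \<Rightarrow> nat list \<Rightarrow> int list set" where
  "signings d s w = {\<sigma>. garage_signs w \<sigma> \<and> open_signs d s w \<sigma>}"

text \<open>A \<open>0\<close> read at \<open>d = 0\<close> closes nothing, in accordance with \<open>0 - 1 = 0\<close>.\<close>

definition open_after :: "nat \<Rightarrow> nat \<Rightarrow> nat" where
  "open_after d a = (if a = 0 then d - 1 else if odd a then d else Suc d)"

definition letter_signs :: "nat \<Rightarrow> int \<Rightarrow> nat \<Rightarrow> int set" where
  "letter_signs d s a = (if a = 0 then {0} else if even a \<and> d > 0 then {s} else {1, -1})"

lemma signings_Cons:
  assumes "d > 0 \<longrightarrow> s \<in> {1, -1}"
  shows "signings d s (a # w) = (\<lambda>(t, \<sigma>). t # \<sigma>) `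
    (SIGMA t:letter_signs d s a. signings (open_after d a) (if d > 0 then s else t) w)"
proof -
  have Cons_iff: "t # \<sigma> \<in> signings d s (a # w) \<longleftrightarrow>
      t \<in> letter_signs d s a \<and> \<sigma> \<in> signings (open_after d a) (if d > 0 then s else t) w" for t \<sigma>
  proof -
    consider "a = 0" | "odd a" "a > 0" | "even a" "a > 0" by (cases "a = 0") auto
    then show ?thesis
      using assms open_signs_antimono[of "Suc d" s w \<sigma> 1]
      by cases (auto simp: signings_def garage_signs_Cons open_signs_Cons open_signs_0
          letter_signs_def open_after_def letter_type_def)
  qed
  show ?thesis
  proof (rule set_eqI)
    fix \<tau>
    show "\<tau> \<in> signings d s (a # w) \<longleftrightarrow> \<tau> \<in> (\<lambda>(t, \<sigma>). t # \<sigma>) `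
        (SIGMA t:letter_signs d s a. signings (open_after d a) (if d > 0 then s else t) w)"
    proof (cases \<tau>)
      case Nil
      then show ?thesis by (auto simp: signings_def garage_signs_def)
    qed (auto simp: Cons_iff)
  qed
qed

fun sign_count :: "nat \<Rightarrow> nat list \<Rightarrow> nat" where
  "sign_count d [] = 1"
| "sign_count d (a # w) =
    (if a = 0 \<or> even a \<and> d > 0 then 1 else 2) * sign_count (open_after d a) w"

lemma finite_and_card_signings:
  assumes "d > 0 \<longrightarrow> s \<in> {1, -1}"
  shows "finite (signings d s w) \<and> card (signings d s w) = sign_count d w"
  using assms
proof (induction w arbitrary: d s)
  case Nil
  have "signings d s [] = {[]}"
    by (auto simp: signings_def garage_signs_def open_signs_def)
  then show ?case by simp
next
  case (Cons a w)
  let ?T = "letter_signs d s a" and ?S = "\<lambda>t. signings (open_after d a) (if d > 0 then s else t) w"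
  have IH: "finite (?S t) \<and> card (?S t) = sign_count (open_after d a) w" if "t \<in> ?T" for t
    using that Cons.prems
    by (intro Cons.IH) (auto simp: letter_signs_def open_after_def split: if_splits)
  have "card (signings d s (a # w)) = card (SIGMA t:?T. ?S t)"
    unfolding signings_Cons[OF Cons.prems] by (intro card_image inj_onI) auto
  also have "\<dots> = (\<Sum>t\<in>?T. card (?S t))"
    using IH by (intro card_SigmaI) (auto simp: letter_signs_def)
  also have "\<dots> = card ?T * sign_count (open_after d a) w"
    using IH by simp
  also have "\<dots> = sign_count d (a # w)"
    by (auto simp: letter_signs_def)
  finally show ?case
    using IH by (auto simp: signings_Cons[OF Cons.prems] letter_signs_def)
qed

section \<open>Lukasiewicz words and the kernel equations\<close>

text \<open>
  The letter \<open>a\<close> is a step of height \<open>a - 1\<close>, and a word in \<open>luk_words N h\<close> is a path of length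
  \<open>N\<close> that reaches the level \<open>-h\<close> for the first time at its end.
\<close>

definition luk_words :: "nat \<Rightarrow> nat \<Rightarrow> nat list set" where
  "luk_words N h = {w. length w = N \<and> sum_list w + h = N \<and> (\<forall>i<N. i < sum_list (take i w) + h)}"

lemma luk_words_0: "luk_words 0 h = (if h = 0 then {[]} else {})"
  by (auto simp: luk_words_def)

lemma luk_words_Suc_0: "luk_words (Suc N) 0 = {}"
  by (auto simp: luk_words_def)

lemma luk_words_empty: "N < h \<Longrightarrow> luk_words N h = {}"
  by (auto simp: luk_words_def)

lemma luk_words_Suc_Suc:
  "luk_words (Suc N) (Suc h) = (\<lambda>(a, w). a # w) ` (SIGMA a:{..N}. luk_words N (h + a))"
proof (rule set_eqI)
  fix v
  show "v \<in> luk_words (Suc N) (Suc h) \<longleftrightarrow>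
      v \<in> (\<lambda>(a, w). a # w) ` (SIGMA a:{..N}. luk_words N (h + a))"
    by (cases v) (auto simp: luk_words_def All_less_Suc2 algebra_simps)
qed

lemma finite_luk_words: "finite (luk_words N h)"
proof (rule finite_subset)
  show "luk_words N h \<subseteq> {w. set w \<subseteq> {..N} \<and> length w = N}"
    using member_le_sum_list by (fastforce simp: luk_words_def)
  show "finite {w. set w \<subseteq> {..N} \<and> length w = N}"
    by (rule finite_lists_length_eq) simp
qed

lemma sum_luk_words_Suc_Suc:
  "(\<Sum>w\<in>luk_words (Suc N) (Suc h). F w) = (\<Sum>a\<le>N. \<Sum>w\<in>luk_words N (h + a). F (a # w))"
proof -
  have "(\<Sum>w\<in>luk_words (Suc N) (Suc h). F w) =
      (\<Sum>(a, w)\<in>(SIGMA a:{..N}. luk_words N (h + a)). F (a # w))"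
    unfolding luk_words_Suc_Suc by (subst sum.reindex) (auto intro: inj_onI simp: case_prod_unfold)
  also have "\<dots> = (\<Sum>a\<le>N. \<Sum>w\<in>luk_words N (h + a). F (a # w))"
    by (rule sum.Sigma[symmetric]) (simp_all add: finite_luk_words)
  finally show ?thesis .
qed

definition luk_sum :: "(nat \<Rightarrow> 'a :: comm_ring_1) \<Rightarrow> nat \<Rightarrow> nat \<Rightarrow> 'a" where
  "luk_sum q N h = (\<Sum>w\<in>luk_words N h. \<Prod>a\<leftarrow>w. q a)"

lemma luk_sum_0: "luk_sum q 0 h = (if h = 0 then 1 else 0)"
  by (simp add: luk_sum_def luk_words_0)

lemma luk_sum_Suc_Suc: "luk_sum q (Suc N) (Suc h) = (\<Sum>a\<le>N. q a * luk_sum q N (h + a))"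
  by (simp add: luk_sum_def sum_luk_words_Suc_Suc sum_distrib_left)

text \<open>
  By decomposition at first passages \<open>luk_sum q N h\<close> is the coefficient of \<open>z\<^sup>N\<close> in \<open>T\<^sup>h\<close>, where
  \<open>T = z q(T)\<close>, so \<open>luk_coeff q N g\<close> is the coefficient of \<open>z\<^sup>N\<close> in \<open>g(T)\<close>.
\<close>

definition luk_coeff :: "(nat \<Rightarrow> 'a :: comm_ring_1) \<Rightarrow> nat \<Rightarrow> 'a fps \<Rightarrow> 'a" where
  "luk_coeff q N g = (\<Sum>j\<le>N. fps_nth g j * luk_sum q N j)"

lemma luk_coeff_add: "luk_coeff q N (f + g) = luk_coeff q N f + luk_coeff q N g"
  by (simp add: luk_coeff_def algebra_simps sum.distrib)

lemma luk_coeff_mult: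
  "luk_coeff q N (f * g) = (\<Sum>i\<le>N. fps_nth f i * luk_coeff q N (fps_X ^ i * g))"
proof -
  let ?t = "\<lambda>i j. if j < i then 0 else fps_nth f i * fps_nth g (j - i) * luk_sum q N j"
  have "luk_coeff q N (f * g) = (\<Sum>j\<le>N. \<Sum>i\<le>j. fps_nth f i * fps_nth g (j - i) * luk_sum q N j)"
    by (simp add: luk_coeff_def fps_mult_nth sum_distrib_right atLeast0AtMost)
  also have "\<dots> = (\<Sum>j\<le>N. \<Sum>i\<le>N. ?t i j)"
    by (intro sum.cong refl sum.mono_neutral_cong_left) auto
  also have "\<dots> = (\<Sum>i\<le>N. \<Sum>j\<le>N. ?t i j)"
    by (rule sum.swap)
  also have "\<dots> = (\<Sum>i\<le>N. fps_nth f i * luk_coeff q N (fps_X ^ i * g))"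
    unfolding luk_coeff_def sum_distrib_left fps_X_power_mult_nth by (intro sum.cong refl) auto
  finally show ?thesis .
qed

lemma luk_coeff_X_power: "luk_coeff q N (fps_X ^ h) = luk_sum q N h"
proof -
  have "luk_coeff q N (fps_X ^ h) = (\<Sum>j\<le>N. if h = j then luk_sum q N j else 0)"
    unfolding luk_coeff_def by (intro sum.cong) auto
  then show ?thesis by (simp add: luk_sum_def luk_words_empty)
qed

lemma luk_coeff_X_mult: "luk_coeff q (Suc N) (fps_X * g) = luk_coeff q N (Abs_fps q * g)"
proof -
  have X_power: "luk_sum q (Suc N) (Suc h) = luk_coeff q N (fps_X ^ h * Abs_fps q)" for h
    by (simp add: luk_sum_Suc_Suc luk_coeff_mult[of q N "Abs_fps q"] luk_coeff_X_power
        mult.commute[of "fps_X ^ h"] add.commute flip: power_add)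
  have "luk_coeff q (Suc N) (fps_X * g) = (\<Sum>j\<le>N. fps_nth g j * luk_sum q (Suc N) (Suc j))"
    by (simp add: luk_coeff_def sum.atMost_Suc_shift del: sum.atMost_Suc)
  also have "\<dots> = luk_coeff q N (g * Abs_fps q)"
    unfolding X_power luk_coeff_mult[of q N g] ..
  finally show ?thesis by (simp only: mult.commute)
qed

definition garage_weight :: "(nat \<Rightarrow> 'a :: comm_ring_1) \<Rightarrow> nat \<Rightarrow> nat list \<Rightarrow> 'a" where
  "garage_weight r d w = of_nat (sign_count d w) * (\<Prod>a\<leftarrow>removeAll 0 w. r a)"

definition garage_sum :: "(nat \<Rightarrow> 'a :: comm_ring_1) \<Rightarrow> nat \<Rightarrow> nat \<Rightarrow> nat \<Rightarrow> 'a" where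
  "garage_sum r N h d = (\<Sum>w\<in>luk_words N h. garage_weight r d w)"

definition odd_series :: "(nat \<Rightarrow> 'a :: comm_ring_1) \<Rightarrow> 'a fps" where
  "odd_series r = Abs_fps (\<lambda>a. if odd a then r a else 0)"

definition even_series :: "(nat \<Rightarrow> 'a :: comm_ring_1) \<Rightarrow> 'a fps" where
  "even_series r = Abs_fps (\<lambda>a. if even a \<and> a > 0 then r a else 0)"

lemma fps_nth_two_mult: "fps_nth (2 * f) n = 2 * fps_nth f n"
  by (simp only: mult_2 fps_add_nth)

lemma garage_sum_0: "garage_sum r 0 h d = (if h = 0 then 1 else 0)"
  by (simp add: garage_sum_def luk_words_0 garage_weight_def)

lemma garage_sum_Suc_0: "garage_sum r (Suc N) 0 d = 0"
  by (simp add: garage_sum_def luk_words_Suc_0)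

lemma garage_sum_Suc_Suc:
  "garage_sum r (Suc N) (Suc h) d = (\<Sum>a\<le>N.
     fps_nth 1 a * garage_sum r N (h + a) (d - 1) +
     fps_nth (2 * odd_series r) a * garage_sum r N (h + a) d +
     fps_nth ((if d = 0 then 2 else 1) * even_series r) a * garage_sum r N (h + a) (Suc d))"
  unfolding garage_sum_def sum_luk_words_Suc_Suc
proof (rule sum.cong[OF refl])
  fix a
  let ?G = "\<lambda>e. \<Sum>w\<in>luk_words N (h + a). garage_weight r e w"
  consider "a = 0" | "odd a" "a > 0" | "even a" "a > 0" by (cases "a = 0") auto
  then show "(\<Sum>w\<in>luk_words N (h + a). garage_weight r d (a # w)) =
      fps_nth 1 a * ?G (d - 1) + fps_nth (2 * odd_series r) a * ?G d +
      fps_nth ((if d = 0 then 2 else 1) * even_series r) a * ?G (Suc d)"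
    by cases (auto simp: garage_weight_def open_after_def odd_series_def even_series_def
        fps_nth_two_mult sum_distrib_left mult_ac intro!: sum.cong)
qed

text \<open>
  The assumptions say that the powers of \<open>x\<close> are eigenvectors, with eigenvalue \<open>q\<close>, of the
  transfer operator that reads a letter and updates the number of open even letters.
\<close>

locale garage_kernel =
  fixes r q :: "nat \<Rightarrow> 'a :: comm_ring_1" and x :: "'a fps"
  assumes kernel_closed: "1 + 2 * odd_series r + 2 * even_series r * x = Abs_fps q"
    and kernel_open: "1 + 2 * odd_series r * x + even_series r * x ^ 2 = Abs_fps q * x"
begin

lemma kernel:
  "x ^ (d - 1) + 2 * odd_series r * x ^ d + (if d = 0 then 2 else 1) * even_series r * x ^ Suc d =
    Abs_fps q * x ^ d"
proof (cases d)
  case 0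
  then show ?thesis using kernel_closed by simp
next
  case (Suc e)
  have "x ^ e + 2 * odd_series r * x ^ Suc e + even_series r * x ^ Suc (Suc e) =
      (1 + 2 * odd_series r * x + even_series r * x ^ 2) * x ^ e"
    by (simp add: algebra_simps power2_eq_square)
  also have "\<dots> = Abs_fps q * x ^ Suc e"
    unfolding kernel_open by (simp add: mult.assoc)
  finally show ?thesis using Suc by simp
qed

lemma luk_coeff_Suc_Suc:
  "luk_coeff q (Suc N) (fps_X ^ Suc h * x ^ d) = (\<Sum>a\<le>N.
     fps_nth 1 a * luk_coeff q N (fps_X ^ (h + a) * x ^ (d - 1)) +
     fps_nth (2 * odd_series r) a * luk_coeff q N (fps_X ^ (h + a) * x ^ d) +
     fps_nth ((if d = 0 then 2 else 1) * even_series r) a *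
       luk_coeff q N (fps_X ^ (h + a) * x ^ Suc d))"
proof -
  let ?A = "2 * odd_series r" and ?B = "(if d = 0 then 2 else 1) * even_series r"
  have coeff_mult: "luk_coeff q N (f * (fps_X ^ h * x ^ e)) =
      (\<Sum>a\<le>N. fps_nth f a * luk_coeff q N (fps_X ^ (h + a) * x ^ e))" for f e
    by (simp add: luk_coeff_mult[of q N f] power_add mult_ac)
  have "luk_coeff q (Suc N) (fps_X ^ Suc h * x ^ d) = luk_coeff q N (Abs_fps q * (fps_X ^ h * x ^ d))"
    unfolding power_Suc mult.assoc by (rule luk_coeff_X_mult)
  also have "Abs_fps q * (fps_X ^ h * x ^ d) =
      fps_X ^ h * (x ^ (d - 1) + ?A * x ^ d + ?B * x ^ Suc d)"
    unfolding kernel by (rule mult.left_commute)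
  also have "\<dots> = 1 * (fps_X ^ h * x ^ (d - 1)) + ?A * (fps_X ^ h * x ^ d) + ?B * (fps_X ^ h * x ^ Suc d)"
    by (simp only: distrib_left mult_1 mult.left_commute[of "fps_X ^ h"])
  finally show ?thesis
    by (simp only: luk_coeff_add coeff_mult sum.distrib)
qed

text \<open>
  The bound \<open>d \<le> h\<close> is preserved by every step (a nonzero even letter raises the path by at least one)
  and forces \<open>d = 0\<close> at the end, where the two sides have to be compared.
\<close>

lemma garage_sum_eq_luk_coeff:
  "d \<le> h \<Longrightarrow> garage_sum r N h d = luk_coeff q N (fps_X ^ h * x ^ d)"
proof (induction N arbitrary: h d)
  case 0
  then show ?case
    by (auto simp: garage_sum_0 luk_coeff_def luk_sum_0 fps_X_power_mult_nth)
next
  case (Suc N)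
  show ?case
  proof (cases h)
    case 0
    then show ?thesis
      using Suc.prems luk_coeff_X_power[of q "Suc N" 0]
      by (simp add: garage_sum_Suc_0 luk_sum_def luk_words_Suc_0)
  next
    case (Suc k)
    let ?A = "2 * odd_series r" and ?B = "(if d = 0 then 2 else 1) * even_series r"
    let ?G = "garage_sum r N" and ?C = "\<lambda>h e. luk_coeff q N (fps_X ^ h * x ^ e)"
    have zero_letter: "fps_nth 1 a * ?G (k + a) (d - 1) = fps_nth 1 a * ?C (k + a) (d - 1)" for a
      using Suc Suc.prems by (simp add: Suc.IH)
    have odd_letter: "fps_nth ?A a * ?G (k + a) d = fps_nth ?A a * ?C (k + a) d" for a
    proof (cases "odd a")
      case True
      then have "d \<le> k + a" using Suc Suc.prems by (cases a) auto
      then show ?thesis by (simp add: Suc.IH)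
    qed (simp add: odd_series_def fps_nth_two_mult)
    have even_letter: "fps_nth ?B a * ?G (k + a) (Suc d) = fps_nth ?B a * ?C (k + a) (Suc d)" for a
    proof (cases "even a \<and> a > 0")
      case True
      then have "Suc d \<le> k + a" using Suc Suc.prems by presburger
      then show ?thesis by (simp add: Suc.IH)
    qed (auto simp: even_series_def fps_nth_two_mult)
    show ?thesis
      unfolding Suc garage_sum_Suc_Suc luk_coeff_Suc_Suc zero_letter odd_letter even_letter ..
  qed
qed

lemma garage_sum_eq_luk_sum: "garage_sum r N h 0 = luk_sum q N h"
  using garage_sum_eq_luk_coeff[of 0 h N] by (simp add: luk_coeff_X_power)

end

definition sym_P_even :: "sym fps" where
  "sym_P_even = Abs_fps (\<lambda>k. if even k then sym_P k else 0)"

lemma sym_Q_series: "Abs_fps sym_Q = 2 * odd_series sym_R + (2 * sym_P_even - 1)"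
proof (rule fps_ext)
  fix n
  show "fps_nth (Abs_fps sym_Q) n = fps_nth (2 * odd_series sym_R + (2 * sym_P_even - 1)) n"
    by (cases "n = 0")
      (auto simp: odd_series_def sym_P_even_def sym_Q_eq_double_sym_P sym_R_def fps_nth_two_mult)
qed

lemma even_series_sym_R: "even_series sym_R = (sym_P_even - 1) * sym_P_even"
proof (rule fps_ext)
  fix n
  have "fps_nth ((sym_P_even - 1) * sym_P_even) n =
      (\<Sum>i=0..n. if even i \<and> i > 0 \<and> even (n - i) then sym_P i * sym_P (n - i) else 0)"
    unfolding fps_mult_nth by (intro sum.cong refl) (auto simp: sym_P_even_def)
  also have "\<dots> = (if even n \<and> n > 0 then sym_R n else 0)"
  proof (cases "even n")
    case True
    have "(\<Sum>i=0..n. if even i \<and> i > 0 \<and> even (n - i) then sym_P i * sym_P (n - i) else 0) =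
        (\<Sum>i\<in>(*) 2 ` {1..n div 2}. sym_P i * sym_P (n - i))"
      using True by (intro sum.mono_neutral_cong_right) (auto elim!: evenE)
    also have "\<dots> = (\<Sum>i=1..n div 2. sym_P (2 * i) * sym_P (n - 2 * i))"
      by (subst sum.reindex) (auto intro: inj_onI)
    finally show ?thesis using True by (auto simp: sym_R_def)
  qed (auto intro!: sum.neutral)
  finally show "fps_nth (even_series sym_R) n = fps_nth ((sym_P_even - 1) * sym_P_even) n"
    by (simp add: even_series_def)
qed

lemma garage_kernel_sym:
  assumes "sym_P_even * x = 1"
  shows "garage_kernel sym_R sym_Q x"
proof
  have even_series_x: "even_series sym_R * x = sym_P_even - 1"
    using assms by (simp add: even_series_sym_R mult.assoc)
  then show "1 + 2 * odd_series sym_R + 2 * even_series sym_R * x = Abs_fps sym_Q"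
    unfolding sym_Q_series mult.assoc by simp
  have "even_series sym_R * x ^ 2 = 1 - x"
    using even_series_x assms by (simp add: power2_eq_square left_diff_distrib flip: mult.assoc)
  then show "1 + 2 * odd_series sym_R * x + even_series sym_R * x ^ 2 = Abs_fps sym_Q * x"
    using assms by (simp add: sym_Q_series distrib_right left_diff_distrib mult.assoc)
qed

corollary garage_sum_sym_R: "garage_sum sym_R N h 0 = luk_sum sym_Q N h"
proof -
  have "sym_P_even * fps_right_inverse sym_P_even 1 = 1"
    by (rule fps_right_inverse) (simp add: sym_P_even_def)
  then interpret garage_kernel sym_R sym_Q "fps_right_inverse sym_P_even 1"
    by (rule garage_kernel_sym)
  show ?thesis by (rule garage_sum_eq_luk_sum)
qed

section \<open>Parking functions as words\<close>

definition parking_words :: "nat \<Rightarrow> nat list set" where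
  "parking_words n = {w. length w = n \<and> sum_list w = n \<and> (\<forall>i\<le>n. i \<le> sum_list (take i w))}"

text \<open>The path of a parking word stays nonnegative and ends at \<open>0\<close>; the appended \<open>0\<close> takes it to \<open>-1\<close>.\<close>

lemma bij_betw_parking_words_luk_words:
  "bij_betw (\<lambda>w. w @ [0]) (parking_words n) (luk_words (Suc n) 1)"
proof (rule bij_betw_byWitness[where f' = butlast])
  have ends_in_0: "butlast v @ [0] = v \<and> butlast v \<in> parking_words n" if v: "v \<in> luk_words (Suc n) 1" for v
  proof -
    from v obtain w a where wa: "v = w @ [a]" "length w = n"
      by (cases v rule: rev_cases) (auto simp: luk_words_def)
    with v have sum: "sum_list w + a = n" and take: "\<forall>i\<le>n. i \<le> sum_list (take i w)"
      by (auto simp: luk_words_def less_Suc_eq_le)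
    with wa have "a = 0" by auto
    with wa sum take show ?thesis by (auto simp: parking_words_def)
  qed
  then show "\<forall>v\<in>luk_words (Suc n) 1. butlast v @ [0] = v"
    and "butlast ` luk_words (Suc n) 1 \<subseteq> parking_words n" by auto
  show "(\<lambda>w. w @ [0]) ` parking_words n \<subseteq> luk_words (Suc n) 1"
    by (auto simp: parking_words_def luk_words_def less_Suc_eq_le)
qed simp

lemma sum_luk_words_eq_sum_parking_words:
  "(\<Sum>w\<in>luk_words (Suc n) 1. F w) = (\<Sum>w\<in>parking_words n. F (w @ [0]))"
  by (rule sum.reindex_bij_betw[OF bij_betw_parking_words_luk_words, symmetric])

lemma sign_count_append_0: "sign_count d (w @ [0]) = sign_count d w"
  by (induction w arbitrary: d) simp_all

lemma sum_parking_words_garage_weight: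
  "(\<Sum>w\<in>parking_words n. garage_weight sym_R 0 w) = (\<Sum>w\<in>parking_words n. \<Prod>a\<leftarrow>w. sym_Q a)"
proof -
  have "garage_weight sym_R 0 (w @ [0]) = garage_weight sym_R 0 w" for w
    by (simp add: garage_weight_def sign_count_append_0)
  then have "(\<Sum>w\<in>parking_words n. garage_weight sym_R 0 w) = garage_sum sym_R (Suc n) 1 0"
    unfolding garage_sum_def sum_luk_words_eq_sum_parking_words by simp
  also have "\<dots> = luk_sum sym_Q (Suc n) 1"
    by (rule garage_sum_sym_R)
  also have "\<dots> = (\<Sum>w\<in>parking_words n. \<Prod>a\<leftarrow>w. sym_Q a)"
    unfolding luk_sum_def sum_luk_words_eq_sum_parking_words by simp
  finally show ?thesis .
qed

lemma alpha_eq_count_list: "alpha p k = count_list p k"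
proof -
  have "alpha p k = card {i. i < length p \<and> k = p ! i}"
    unfolding alpha_def
    by (rule bij_betw_same_card[of "\<lambda>j. j - 1"], rule bij_betw_byWitness[where f' = Suc]) auto
  then show ?thesis
    by (simp add: count_list_eq_length_filter length_filter_conv_card)
qed

definition content :: "nat \<Rightarrow> nat list \<Rightarrow> nat list" where
  "content n p = map (alpha p) [1..<Suc n]"

lemma length_content [simp]: "length (content n p) = n"
  by (simp add: content_def)

lemma nth_content: "i < n \<Longrightarrow> content n p ! i = alpha p (Suc i)"
  by (simp add: content_def del: upt_Suc)

lemma bij_betw_content:
  "bij_betw (content n) {p. sorted p \<and> set p \<subseteq> {1..n}} {w. length w = n}"
  unfolding bij_betw_def
proof (intro conjI inj_onI equalityI subsetI)
  fix p q assume p: "p \<in> {p. sorted p \<and> set p \<subseteq> {1..n}}" and q: "q \<in> {p. sorted p \<and> set p \<subseteq> {1..n}}"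
    and eq: "content n p = content n q"
  have "count_list p k = count_list q k" for k
  proof (cases "k \<in> {1..n}")
    case True
    then show ?thesis
      using arg_cong[OF eq, of "\<lambda>w. w ! (k - 1)"]
      by (cases k) (simp_all add: nth_content alpha_eq_count_list)
  next
    case False
    then have "k \<notin> set p" "k \<notin> set q" using p q by auto
    then show ?thesis by (simp add: count_list_0_iff)
  qed
  then have "mset p = mset q"
    by (intro multiset_eqI) (simp add: count_mset)
  then show "p = q"
    using p q properties_for_sort[of p q] by (simp add: sorted_sort_id)
next
  fix w :: "nat list" assume "w \<in> {w. length w = n}"
  define M where "M = Abs_multiset (\<lambda>k. if k \<in> {1..n} then w ! (k - 1) else 0)"
  have count: "count M k = (if k \<in> {1..n} then w ! (k - 1) else 0)" for k
    unfolding M_def by (subst count_Abs_multiset) (auto intro: finite_subset[of _ "{1..n}"])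
  have "content n (sorted_list_of_multiset M) = w"
    using \<open>w \<in> _\<close>
    by (intro nth_equalityI) (simp_all add: nth_content alpha_eq_count_list count flip: count_mset)
  moreover have "set (sorted_list_of_multiset M) \<subseteq> {1..n}"
    by (auto simp: set_mset_def count split: if_splits)
  ultimately show "w \<in> content n ` {p. sorted p \<and> set p \<subseteq> {1..n}}"
    by (intro image_eqI[of _ _ "sorted_list_of_multiset M"]) simp_all
qed auto

lemma sorted_nth_le_iff:
  fixes p :: "'a :: linorder list"
  shows "sorted p \<Longrightarrow> i < length p \<Longrightarrow> p ! i \<le> c \<longleftrightarrow> i < length (filter (\<lambda>x. x \<le> c) p)"
proof (induction p arbitrary: i)
  case (Cons x p)
  show ?case
  proof (cases "x \<le> c")
    case True
    then show ?thesis using Cons by (cases i) auto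
  next
    case False
    then have "\<forall>y\<in>set (x # p). \<not> y \<le> c"
      using Cons.prems by auto
    moreover have "(x # p) ! i \<in> set (x # p)"
      using Cons.prems by (intro nth_mem)
    ultimately show ?thesis
      by (auto simp: filter_empty_conv)
  qed
qed simp

lemma sum_take_content:
  assumes "set p \<subseteq> {1..}" "i \<le> n"
  shows "sum_list (take i (content n p)) = length (filter (\<lambda>x. x \<le> i) p)"
proof -
  have "take i (content n p) = map (alpha p) [1..<Suc i]"
    unfolding content_def take_map using assms(2) by (simp add: take_upt del: upt_Suc)
  then have "sum_list (take i (content n p)) = (\<Sum>k=1..i. count_list p k)"
    by (simp add: alpha_eq_count_list sum_list_distinct_conv_sum_set atLeastLessThanSuc_atLeastAtMost
        del: upt_Suc)
  also have "\<dots> = (\<Sum>k=1..i. count_list (filter (\<lambda>x. x \<le> i) p) k)"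
    by (intro sum.cong) (simp_all flip: count_mset)
  also have "\<dots> = length (filter (\<lambda>x. x \<le> i) p)"
    using assms(1) by (intro sum_count_set) auto
  finally show ?thesis .
qed

lemma set_Pf:
  assumes "p \<in> Pf n"
  shows "set p \<subseteq> {1..n}"
proof
  fix x assume x: "x \<in> set p"
  then obtain i where "i < n" "sort p ! i = x"
    using assms by (metis (mono_tags, lifting) Pf_def in_set_conv_nth length_sort mem_Collect_eq set_sort)
  then show "x \<in> {1..n}"
    using assms x by (auto simp: Pf_def dest!: bspec[of _ _ "Suc i"])
qed

lemma sorted_Pf_iff_content:
  assumes "sorted p" "set p \<subseteq> {1..n}"
  shows "p \<in> Pf n \<longleftrightarrow> content n p \<in> parking_words n"
proof -
  have prefix_sum: "sum_list (take i (content n p)) = length (filter (\<lambda>x. x \<le> i) p)" if "i \<le> n" for i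
    using assms(2) that by (intro sum_take_content) auto
  have total: "sum_list (content n p) = length p"
    using prefix_sum[of n] assms(2) by (simp add: subset_eq)
  have "(\<forall>i\<in>{1..n}. sort p ! (i - 1) \<le> i) \<longleftrightarrow> (\<forall>i\<le>n. i \<le> sum_list (take i (content n p)))"
    if "length p = n"
  proof -
    have "sort p ! (i - 1) \<le> i \<longleftrightarrow> i \<le> sum_list (take i (content n p))" if "i \<in> {1..n}" for i
      using sorted_nth_le_iff[OF assms(1), of "i - 1" i] that \<open>length p = n\<close> assms(1)
      by (cases i) (auto simp: prefix_sum sorted_sort_id Suc_le_eq)
    moreover have "(\<forall>i\<le>n. P i) \<longleftrightarrow> P 0 \<and> (\<forall>i\<in>{1..n}. P i)" for P
      by (metis One_nat_def Suc_leI atLeastAtMost_iff le0 not_gr_zero)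
    ultimately show ?thesis by simp
  qed
  then show ?thesis
    using total assms(2) by (auto simp: Pf_def parking_words_def)
qed

lemma bij_betw_sorted_Pf_parking_words:
  "bij_betw (content n) {p \<in> Pf n. sorted p} (parking_words n)"
proof -
  have "bij_betw (content n) {p \<in> {p. sorted p \<and> set p \<subseteq> {1..n}}. p \<in> Pf n}
      {w \<in> {w. length w = n}. w \<in> parking_words n}"
    by (rule bij_betw_Collect[OF bij_betw_content]) (simp add: sorted_Pf_iff_content)
  moreover have "{p \<in> {p. sorted p \<and> set p \<subseteq> {1..n}}. p \<in> Pf n} = {p \<in> Pf n. sorted p}"
    using set_Pf by auto
  moreover have "{w \<in> {w. length w = n}. w \<in> parking_words n} = parking_words n"
    by (auto simp: parking_words_def)
  ultimately show ?thesis by simp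
qed

lemma lam_eq_mset_content:
  assumes "set p \<subseteq> {1..n}"
  shows "lam p = mset (removeAll 0 (content n p))"
proof -
  have "{k. alpha p k \<noteq> 0} = set (filter (\<lambda>k. alpha p k \<noteq> 0) [1..<Suc n])"
    using assms by (auto simp: alpha_eq_count_list count_list_0_iff simp del: upt_Suc)
  then have "lam p = image_mset (alpha p) (mset (filter (\<lambda>k. alpha p k \<noteq> 0) [1..<Suc n]))"
    unfolding lam_def by (simp only: mset_set_set distinct_filter distinct_upt)
  then show ?thesis
    by (simp add: content_def removeAll_filter_not_eq filter_map comp_def eq_commute[of 0]
        del: upt_Suc mset_filter flip: mset_map)
qed

lemma letter_type_alpha: "letter_type (alpha p i) = upsilon p i"
  by (simp add: letter_type_def upsilon_def)

lemma letter_types_between_content: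
  assumes "i < j" "j < n"
  shows "map letter_type (take (j - Suc i) (drop (Suc i) (content n p))) =
    map (upsilon p) [Suc i + 1..<Suc j]"
  unfolding content_def drop_map take_map drop_upt
  using assms by (simp add: take_upt letter_type_alpha del: upt_Suc)

lemma Gar_iff_garage_signs:
  "(p, \<sigma>) \<in> Gar n \<longleftrightarrow> p \<in> Pf n \<and> sorted p \<and> garage_signs (content n p) \<sigma>"
proof -
  have index_shift: "(\<forall>k\<in>{1..n}. P k) \<longleftrightarrow> (\<forall>i<n. P (Suc i))" for P
    unfolding image_Suc_lessThan[symmetric] by auto
  have "(p, \<sigma>) \<in> Gar n \<longleftrightarrow> p \<in> Pf n \<and> sorted p \<and> length \<sigma> = n \<and>
      (\<forall>i<n. \<sigma> ! i \<in> {-1, 0, 1} \<and> (\<sigma> ! i = 0 \<longleftrightarrow> alpha p (Suc i) = 0)) \<and>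
      (\<forall>i<n. \<forall>j<n. i < j \<and> upsilon p (Suc i) = 2 \<and> upsilon p (Suc j) = 2 \<and>
        ballot 0 (map (upsilon p) [Suc i + 1..<Suc j]) \<longrightarrow> \<sigma> ! i = \<sigma> ! j)"
    unfolding Gar_def naive_shifted_pf_def index_shift ballot_def
    by (auto simp: subset_eq all_set_conv_all_nth simp del: upt_Suc)
  also have "\<dots> \<longleftrightarrow> p \<in> Pf n \<and> sorted p \<and> garage_signs (content n p) \<sigma>"
    unfolding garage_signs_def
    by (auto simp: nth_content letter_type_alpha letter_types_between_content simp del: upt_Suc)
  finally show ?thesis .
qed

lemma Gar_eq_Sigma_signings:
  "Gar n = (SIGMA p:{p \<in> Pf n. sorted p}. signings 0 s (content n p))"
  by (auto simp: signings_def open_signs_0 Gar_iff_garage_signs)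

lemma sum_Gar_R_part:
  "(\<Sum>(p, \<sigma>)\<in>Gar n. R_part (lam p)) = (\<Sum>w\<in>parking_words n. garage_weight sym_R 0 w)"
proof -
  let ?A = "{p \<in> Pf n. sorted p}"
  have "(\<Sum>(p, \<sigma>)\<in>Gar n. R_part (lam p)) =
      (\<Sum>p\<in>?A. \<Sum>\<sigma>\<in>signings 0 1 (content n p). R_part (lam p))"
    unfolding Gar_eq_Sigma_signings[of n 1]
    by (rule sum.Sigma[symmetric]) (simp_all add: finite_Pf finite_and_card_signings)
  also have "\<dots> = (\<Sum>p\<in>?A. garage_weight sym_R 0 (content n p))"
  proof (rule sum.cong[OF refl])
    fix p assume "p \<in> ?A"
    then have "lam p = mset (removeAll 0 (content n p))"
      using set_Pf by (intro lam_eq_mset_content) auto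
    then show "(\<Sum>\<sigma>\<in>signings 0 1 (content n p). R_part (lam p)) = garage_weight sym_R 0 (content n p)"
      by (simp add: R_part_def garage_weight_def finite_and_card_signings prod_mset_prod_list flip: mset_map)
  qed
  also have "\<dots> = (\<Sum>w\<in>parking_words n. garage_weight sym_R 0 w)"
    by (rule sum.reindex_bij_betw[OF bij_betw_sorted_Pf_parking_words])
  finally show ?thesis .
qed

lemma sh_PF:
  assumes "is_sh sh"
  shows "sh (PF n) = (\<Sum>w\<in>parking_words n. \<Prod>a\<leftarrow>w. sym_Q a)"
proof -
  interpret sh: Vector_Spaces.linear sym_scale sym_scale sh
    using assms by (simp add: is_sh_def sym_alg_endo_def)
  have "sh (PF n) = (\<Sum>p | p \<in> Pf n \<and> sorted p. \<Prod>k\<in>#lam p. sym_Q k)"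
    using assms by (simp add: PF_def sh.sum sh_h_part)
  also have "\<dots> = (\<Sum>p | p \<in> Pf n \<and> sorted p. \<Prod>a\<leftarrow>content n p. sym_Q a)"
  proof (rule sum.cong[OF refl], clarify)
    fix p assume "p \<in> Pf n"
    have "prod_list (map sym_Q (removeAll 0 w)) = prod_list (map sym_Q w)" for w
      by (induction w) simp_all
    then show "(\<Prod>k\<in>#lam p. sym_Q k) = (\<Prod>a\<leftarrow>content n p. sym_Q a)"
      by (simp add: lam_eq_mset_content[OF set_Pf[OF \<open>p \<in> Pf n\<close>]] prod_mset_prod_list flip: mset_map)
  qed
  also have "\<dots> = (\<Sum>w\<in>parking_words n. \<Prod>a\<leftarrow>w. sym_Q a)"
    by (rule sum.reindex_bij_betw[OF bij_betw_sorted_Pf_parking_words])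
  finally show ?thesis .
qed

theorem theorem3p9:
  fixes n :: nat and sh :: "sym \<Rightarrow> sym"
  assumes "is_sh sh" and "n \<ge> 1"
  shows "sh (PF n) = (\<Sum>(p, \<sigma>)\<in>Gar n. R_part (lam p))"
proof -
  have "sh (PF n) = (\<Sum>w\<in>parking_words n. \<Prod>a\<leftarrow>w. sym_Q a)"
    using assms(1) by (rule sh_PF)
  also have "\<dots> = (\<Sum>w\<in>parking_words n. garage_weight sym_R 0 w)"
    by (rule sum_parking_words_garage_weight[symmetric])
  also have "\<dots> = (\<Sum>(p, \<sigma>)\<in>Gar n. R_part (lam p))"
    by (rule sum_Gar_R_part[symmetric])
  finally show ?thesis .
qed

end
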